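(* Suppose that $x_{i,j}\in\mathcal D$ for all $1\le i\le m$, $1\le j\le n_i$. Then there is a non-decreasing $\theta\in\Theta^m$ such that $I(\theta)=0$, $\ell(\theta\mid\mathbf x)>0$ and, for all non-decreasing $\lambda\in\Theta^m$, $$\ell(\lambda\mid\mathbf x)\le \ell(\theta\mid\mathbf x).$$
   Context: Setting. $\{f(x\mid\theta):\theta\in\Theta\}$ is a one-parameter family of probability density functions on $\mathbb R$, with $\Theta\subset\mathbb R$. Put $\mathcal D=\{x\in\mathbb R: (\exists\theta\in\Theta)\ f(x\mid\theta)>0\}$; elements of $\mathcal D$ are called observable. Standing assumptions: (1) Either all the $f(\cdot\mid\theta)$ are PDFs (probability mass functions) of discrete real random variables, or all of them are PDFs of absolutely continuous real random variables; in particular $f\ge 0$. (2) $\mathcal D\subset\Theta$ and $\Theta$ is a real interval of positive length. (3) For every $t\ge1$ and all $y_1,\dots,y_t\in\mathcal D$, with arithmetic mean $\overline y$, the function $\theta\mapsto L(\theta\mid\mathbf y)=\prod_{s=1}^t f(y_s\mid\theta)$ is strictly increasing on $\{\theta\in\Theta:\theta\le\overline y\}$ and strictly decreasing on $\{\theta\in\Theta:\theta\ge\overline y\}$. Data. $m\ge1$ and $n_1,\dots,n_m\ge1$ are integers, and $\mathbf x=(x_{i,j})_{1\le i\le m,\,1\le j\le n_i}$ is a doubly-indexed vector of real numbers (observations of independent random variables $X_{i,j}$ with PDF $f(\cdot\mid\theta_i)$). For $\lambda=\langle\lambda_1,\dots,\lambda_m\rangle\in\Theta^m$, the compound likelihood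 is $\ell(\lambda\mid\mathbf x)=\prod_{i=1}^m\prod_{j=1}^{n_i}f(x_{i,j}\mid\lambda_i)$. A vector $\lambda\in\Theta^m$ is non-decreasing if $i\le k$ implies $\lambda_i\le\lambda_k$. Notation. $[a\dots b]$ is the set of integers in the real interval $[a,b]$. For nonempty $J\subset[1\dots m]$, $\mu(J)=\dfrac{\sum_{i\in J}\sum_{j=1}^{n_i}x_{i,j}}{\sum_{i\in J}n_i}$. Index. For $\theta\in\Theta^m$ let $\tau_1,\dots,\tau_s$ list the distinct components of $\theta$ without repetition, and let $A_t=\{i\in[1\dots m]:\theta_i=\tau_t\}$. The index $I(\theta)$ is the number of $t\in[1\dots s]$ such that $\tau_t\ne\mu(A_t)$. *)

theory Defs
  imports "HOL-Probability.Probability"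
begin

text \<open>
  The family is a function \<open>f\<close> with \<open>f x \<theta>\<close> standing for $f(x\mid\theta)$; its values at parameters
  outside \<open>\<Theta>\<close> are never constrained and never matter.
\<close>

definition discrete_pdf :: "(real \<Rightarrow> real) \<Rightarrow> bool" where
  "discrete_pdf g \<longleftrightarrow> (\<exists>p :: real pmf. \<forall>x. g x = pmf p x)"

text \<open>
  Densities are only required to be Lebesgue measurable; every Borel density with respect to
  \<open>lborel\<close> is included. The measurability conjunct is needed because \<open>density\<close> is total.
\<close>

definition continuous_pdf :: "(real \<Rightarrow> real) \<Rightarrow> bool" where
  "continuous_pdf g \<longleftrightarrow>
     g \<in> borel_measurable lebesgue \<and> (\<forall>x. 0 \<le> g x) \<and> prob_space (density lebesgue g)"

definition pdf_family :: "(real \<Rightarrow> real \<Rightarrow> real) \<Rightarrow> real set \<Rightarrow> bool" where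
  "pdf_family f \<Theta> \<longleftrightarrow>
     (\<forall>\<theta>\<in>\<Theta>. discrete_pdf (\<lambda>x. f x \<theta>)) \<or> (\<forall>\<theta>\<in>\<Theta>. continuous_pdf (\<lambda>x. f x \<theta>))"

definition observable :: "(real \<Rightarrow> real \<Rightarrow> real) \<Rightarrow> real set \<Rightarrow> real set" where
  "observable f \<Theta> = {x. \<exists>\<theta>\<in>\<Theta>. f x \<theta> > 0}"

definition likelihood :: "(real \<Rightarrow> real \<Rightarrow> real) \<Rightarrow> nat \<Rightarrow> (nat \<Rightarrow> real) \<Rightarrow> real \<Rightarrow> real" where
  "likelihood f t y \<theta> = (\<Prod>s = 1..t. f (y s) \<theta>)"

definition arith_mean :: "nat \<Rightarrow> (nat \<Rightarrow> real) \<Rightarrow> real" where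
  "arith_mean t y = (\<Sum>s = 1..t. y s) / real t"

definition likelihood_unimodal :: "(real \<Rightarrow> real \<Rightarrow> real) \<Rightarrow> real set \<Rightarrow> bool" where
  "likelihood_unimodal f \<Theta> \<longleftrightarrow>
     (\<forall>t\<ge>1. \<forall>y. (\<forall>s\<in>{1..t}. y s \<in> observable f \<Theta>) \<longrightarrow>
        strict_mono_on {\<theta>\<in>\<Theta>. \<theta> \<le> arith_mean t y} (likelihood f t y) \<and>
        strict_antimono_on {\<theta>\<in>\<Theta>. \<theta> \<ge> arith_mean t y} (likelihood f t y))"

text \<open>
  Vectors in $\Theta^m$ are functions in \<open>{1..m} \<rightarrow> \<Theta>\<close>; values at other indices play no role.
\<close>

definition compound_likelihood ::
    "(real \<Rightarrow> real \<Rightarrow> real) \<Rightarrow> nat \<Rightarrow> (nat \<Rightarrow> nat) \<Rightarrow> (nat \<Rightarrow> nat \<Rightarrow> real) \<Rightarrow> (nat \<Rightarrow> real) \<Rightarrow> real" where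
  "compound_likelihood f m n x \<theta> = (\<Prod>i = 1..m. \<Prod>j = 1..n i. f (x i j) (\<theta> i))"

definition block_mean :: "(nat \<Rightarrow> nat) \<Rightarrow> (nat \<Rightarrow> nat \<Rightarrow> real) \<Rightarrow> nat set \<Rightarrow> real" where
  "block_mean n x J = (\<Sum>i\<in>J. \<Sum>j = 1..n i. x i j) / real (\<Sum>i\<in>J. n i)"

definition level_index :: "nat \<Rightarrow> (nat \<Rightarrow> nat) \<Rightarrow> (nat \<Rightarrow> nat \<Rightarrow> real) \<Rightarrow> (nat \<Rightarrow> real) \<Rightarrow> nat" where
  "level_index m n x \<theta> =
     card {\<tau> \<in> \<theta> ` {1..m}. \<tau> \<noteq> block_mean n x {i \<in> {1..m}. \<theta> i = \<tau>}}"

end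

theory Submission
  imports Defs
begin

text \<open>
  A non-decreasing vector of positive index has a level set \<open>A\<close> whose value \<open>\<tau>\<close> differs from the
  block mean. Moving \<open>\<tau>\<close> towards that mean, until it reaches the mean or meets the neighbouring
  value, keeps the vector non-decreasing and increases the likelihood of the block. Either the number
  of distinct values drops (two blocks merge, the index does not grow) or the index drops, so
  after finitely many steps every vector is dominated by one of index zero. There are only finitely
  many vectors of index zero, since their values are block means, and the best of them is the
  maximizer. Its likelihood is positive because each block sits at the strict maximum of a
  nonnegative function.
\<close>

lemma pdf_family_nonneg:
  assumes "pdf_family f \<Theta>" and "v \<in> \<Theta>"
  shows "0 \<le> f y v"
  using assms unfolding pdf_family_def discrete_pdf_def continuous_pdf_def
  by (metis pmf_nonneg)

section \<open>Unimodality of the likelihood of a finite sample\<close>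

context
  fixes f :: "real \<Rightarrow> real \<Rightarrow> real" and \<Theta> :: "real set"
  assumes nonneg: "\<And>y v. v \<in> \<Theta> \<Longrightarrow> 0 \<le> f y v"
    and obs: "observable f \<Theta> \<subseteq> \<Theta>"
    and interval: "is_interval \<Theta>"
    and nontrivial: "\<exists>a\<in>\<Theta>. \<exists>b\<in>\<Theta>. a < b"
    and unimodal: "likelihood_unimodal f \<Theta>"
begin

text \<open>Unimodality is assumed for samples listed as \<open>1..t\<close>. Enumerating
  \<open>S\<close> by a bijection transfers it to any finite index set, as needed for doubly-indexed
  observations.\<close>

lemma finite_set_unimodal:
  fixes z :: "'i \<Rightarrow> real"
  assumes "finite S" and "S \<noteq> {}" and z: "z ` S \<subseteq> observable f \<Theta>"
  defines "\<mu> \<equiv> (\<Sum>s\<in>S. z s) / real (card S)"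
  shows "\<mu> \<in> \<Theta>"
    and "strict_mono_on {v\<in>\<Theta>. v \<le> \<mu>} (\<lambda>v. \<Prod>s\<in>S. f (z s) v)"
    and "strict_antimono_on {v\<in>\<Theta>. \<mu> \<le> v} (\<lambda>v. \<Prod>s\<in>S. f (z s) v)"
proof -
  obtain b where b: "bij_betw b {1..card S} S"
    using ex_bij_betw_nat_finite_1[OF \<open>finite S\<close>] by blast
  have card: "card S \<ge> 1"
    using assms(1,2) by (simp add: Suc_le_eq card_gt_0_iff)
  have mean: "arith_mean (card S) (z \<circ> b) = \<mu>"
    unfolding arith_mean_def \<mu>_def using sum.reindex_bij_betw[OF b, of z] by simp
  have lik: "likelihood f (card S) (z \<circ> b) = (\<lambda>v. \<Prod>s\<in>S. f (z s) v)"
    unfolding likelihood_def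
    using prod.reindex_bij_betw[OF b, of "\<lambda>s. f (z s) _"] by (simp add: fun_eq_iff)
  have "\<forall>s\<in>{1..card S}. (z \<circ> b) s \<in> observable f \<Theta>"
    using b z by (auto simp: bij_betw_def)
  then show "strict_mono_on {v\<in>\<Theta>. v \<le> \<mu>} (\<lambda>v. \<Prod>s\<in>S. f (z s) v)"
    and "strict_antimono_on {v\<in>\<Theta>. \<mu> \<le> v} (\<lambda>v. \<Prod>s\<in>S. f (z s) v)"
    using unimodal card unfolding likelihood_unimodal_def mean[symmetric] lik[symmetric] by blast+
  \<comment> \<open>The mean is a convex combination, with equal weights, of observable points;
    these lie in the convex set \<Theta>.\<close>
  have "(\<Sum>s\<in>S. (1 / real (card S)) *\<^sub>R z s) \<in> \<Theta>"
    using z obs interval assms(1,2)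
    by (intro convex_sum) (auto simp: is_interval_convex)
  then show "\<mu> \<in> \<Theta>"
    by (simp add: \<mu>_def sum_divide_distrib)
qed

section \<open>Likelihood of a block of indices sharing one parameter\<close>

context
  fixes m :: nat and n :: "nat \<Rightarrow> nat" and x :: "nat \<Rightarrow> nat \<Rightarrow> real"
  assumes n_pos: "\<And>i. i \<in> {1..m} \<Longrightarrow> n i \<ge> 1"
    and x_obs: "\<And>i j. i \<in> {1..m} \<Longrightarrow> j \<in> {1..n i} \<Longrightarrow> x i j \<in> observable f \<Theta>"
begin

abbreviation block_likelihood :: "nat set \<Rightarrow> real \<Rightarrow> real" where
  "block_likelihood A v \<equiv> \<Prod>i\<in>A. \<Prod>j = 1..n i. f (x i j) v"

abbreviation level_set :: "(nat \<Rightarrow> real) \<Rightarrow> real \<Rightarrow> nat set" where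
  "level_set \<theta> v \<equiv> {i \<in> {1..m}. \<theta> i = v}"

text \<open>This is the set counted by \<open>level_index\<close>. Having the set itself makes it
  possible to compare two indices by inclusion.\<close>

abbreviation bad_levels :: "(nat \<Rightarrow> real) \<Rightarrow> real set" where
  "bad_levels \<theta> \<equiv> {v \<in> \<theta> ` {1..m}. v \<noteq> block_mean n x (level_set \<theta> v)}"

abbreviation admissible :: "(nat \<Rightarrow> real) \<Rightarrow> bool" where
  "admissible \<theta> \<equiv> \<theta> \<in> {1..m} \<rightarrow> \<Theta> \<and> mono_on {1..m} \<theta>"

text \<open>All observations of the block form one sample indexed by the pairs in
  \<open>Sigma A (\<lambda>i. {1..n i})\<close>. Its arithmetic mean is the block mean and its
  likelihood is the block likelihood, so \<open>finite_set_unimodal\<close> applies.\<close>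

lemma
  assumes "A \<subseteq> {1..m}" and "A \<noteq> {}"
  shows block_mean_mem: "block_mean n x A \<in> \<Theta>"
    and block_likelihood_strict_mono:
      "strict_mono_on {v\<in>\<Theta>. v \<le> block_mean n x A} (block_likelihood A)"
    and block_likelihood_strict_antimono:
      "strict_antimono_on {v\<in>\<Theta>. block_mean n x A \<le> v} (block_likelihood A)"
proof -
  define S where "S = Sigma A (\<lambda>i. {1..n i})"
  have "finite A" using assms finite_subset by blast
  then have "finite S" by (simp add: S_def)
  obtain i where "i \<in> A" using assms by blast
  then have "(i, 1) \<in> S" using n_pos[of i] assms by (auto simp: S_def)
  then have "S \<noteq> {}" by blast
  have obs_S: "(\<lambda>(i, j). x i j) ` S \<subseteq> observable f \<Theta>"
    using x_obs assms by (auto simp: S_def subset_iff)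
  have mean: "(\<Sum>(i, j)\<in>S. x i j) / real (card S) = block_mean n x A"
    using \<open>finite A\<close> by (simp add: S_def block_mean_def sum.Sigma)
  have lik: "(\<lambda>v. \<Prod>s\<in>S. f (case s of (i, j) \<Rightarrow> x i j) v) = block_likelihood A"
    using \<open>finite A\<close> by (simp add: S_def fun_eq_iff prod.Sigma split_def)
  note * = finite_set_unimodal[OF \<open>finite S\<close> \<open>S \<noteq> {}\<close> obs_S, unfolded mean lik]
  show "block_mean n x A \<in> \<Theta>"
    and "strict_mono_on {v\<in>\<Theta>. v \<le> block_mean n x A} (block_likelihood A)"
    and "strict_antimono_on {v\<in>\<Theta>. block_mean n x A \<le> v} (block_likelihood A)"
    by (rule *)+
qed

lemma block_likelihood_nonneg:
  "v \<in> \<Theta> \<Longrightarrow> 0 \<le> block_likelihood A v"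
  by (intro prod_nonneg ballI nonneg)

text \<open>Both branches of unimodality in one form: a move towards the block mean that does not
  pass it pays off. The disjunction is the one delivered by
  \<open>ex_next_value_toward\<close>.\<close>

lemma block_likelihood_less:
  assumes "A \<subseteq> {1..m}" and "A \<noteq> {}" and "u \<in> \<Theta>" and "v \<in> \<Theta>"
    and "u < v \<and> v \<le> block_mean n x A \<or> block_mean n x A \<le> v \<and> v < u"
  shows "block_likelihood A u < block_likelihood A v"
  using assms(5)
proof (elim disjE)
  assume "u < v \<and> v \<le> block_mean n x A"
  then show ?thesis
    using strict_mono_onD[OF block_likelihood_strict_mono[OF assms(1,2)], of u v] assms by auto
next
  assume "block_mean n x A \<le> v \<and> v < u"
  then show ?thesis
    using monotone_onD[OF block_likelihood_strict_antimono[OF assms(1,2)], of v u] assms by auto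
qed

lemma block_likelihood_mean_pos:
  assumes "A \<subseteq> {1..m}" and "A \<noteq> {}"
  shows "0 < block_likelihood A (block_mean n x A)"
proof -
  \<comment> \<open>Positive length of \<Theta> supplies a second parameter; its nonnegative
    likelihood lies strictly below the one at the mean.\<close>
  obtain u where u: "u \<in> \<Theta>" "u \<noteq> block_mean n x A"
    using nontrivial by (metis less_irrefl)
  then have "block_likelihood A u < block_likelihood A (block_mean n x A)"
    by (intro block_likelihood_less assms block_mean_mem) auto
  then show ?thesis
    using block_likelihood_nonneg[OF u(1), of A] by linarith
qed

section \<open>Factoring the compound likelihood over blocks\<close>

lemma compound_likelihood_split:
  assumes "A \<subseteq> {1..m}"
  shows "compound_likelihood f m n x \<theta> =
    (\<Prod>i\<in>{1..m} - A. \<Prod>j = 1..n i. f (x i j) (\<theta> i)) * (\<Prod>i\<in>A. \<Prod>j = 1..n i. f (x i j) (\<theta> i))"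
  unfolding compound_likelihood_def by (rule prod.subset_diff) (use assms in auto)

lemma level_index_zeroD:
  assumes "level_index m n x \<theta> = 0" and "i \<in> {1..m}"
  shows "\<theta> i = block_mean n x (level_set \<theta> (\<theta> i))"
  using assms by (auto simp: level_index_def)

lemma level_index_zero_pos:
  assumes "level_index m n x \<theta> = 0"
  shows "0 < compound_likelihood f m n x \<theta>"
proof -
  have "compound_likelihood f m n x \<theta> =
      (\<Prod>v\<in>\<theta> ` {1..m}. \<Prod>i\<in>level_set \<theta> v. \<Prod>j = 1..n i. f (x i j) (\<theta> i))"
    unfolding compound_likelihood_def by (rule prod.image_gen) simp
  also have "\<dots> = (\<Prod>v\<in>\<theta> ` {1..m}. block_likelihood (level_set \<theta> v) v)"
    by (intro prod.cong) auto
  also have "\<dots> > 0"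
  proof (rule prod_pos)
    fix v assume "v \<in> \<theta> ` {1..m}"
    then obtain i where "i \<in> {1..m}" "v = \<theta> i" by blast
    then have "level_set \<theta> v \<noteq> {}" and mean: "block_mean n x (level_set \<theta> v) = v"
      using level_index_zeroD[OF assms, symmetric] by auto
    then show "0 < block_likelihood (level_set \<theta> v) v"
      using block_likelihood_mean_pos[of "level_set \<theta> v", unfolded mean] by blast
  qed
  finally show ?thesis .
qed

section \<open>A single improvement step\<close>

text \<open>Here \<open>v\<close> is the first obstacle on the way from \<open>u\<close> to
  \<open>w\<close>: the point nearest to \<open>u\<close> among \<open>w\<close> and the elements of
  \<open>V\<close> on the same side of \<open>u\<close>.\<close>

lemma ex_next_value_toward:
  fixes V :: "real set"
  assumes "finite V" and "u \<noteq> w"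
  obtains v where "u < v \<and> v \<le> w \<or> w \<le> v \<and> v < u" and "v = w \<or> v \<in> V"
    and "\<And>y. y \<in> V \<Longrightarrow> \<not> (u < y \<and> y < v)" and "\<And>y. y \<in> V \<Longrightarrow> \<not> (v < y \<and> y < u)"
proof (cases "u < w")
  case True
  define W where "W = insert w {y\<in>V. u < y}"
  have W: "finite W" "W \<noteq> {}" using assms by (auto simp: W_def)
  have le: "Min W \<le> y" if "y \<in> W" for y using W that by simp
  have "Min W \<in> W" using W by (rule Min_in)
  then show ?thesis
    using le True by (intro that[of "Min W"]) (fastforce simp: W_def)+
next
  case False
  define W where "W = insert w {y\<in>V. y < u}"
  have W: "finite W" "W \<noteq> {}" using assms by (auto simp: W_def)
  have ge: "y \<le> Max W" if "y \<in> W" for y using W that by simp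
  have "Max W \<in> W" using W by (rule Max_in)
  then show ?thesis
    using ge False assms(2) by (intro that[of "Max W"]) (fastforce simp: W_def)+
qed

text \<open>The number of distinct values may stay the same when the index drops, and the index may
  stay the same when blocks merge. Their sum decreases in either case and serves as termination
  measure.\<close>

lemma improvement_step:
  assumes adm: "admissible \<theta>" and "level_index m n x \<theta> \<noteq> 0"
  obtains \<eta> where "admissible \<eta>"
    and "compound_likelihood f m n x \<theta> \<le> compound_likelihood f m n x \<eta>"
    and "card (\<eta> ` {1..m}) + level_index m n x \<eta> < card (\<theta> ` {1..m}) + level_index m n x \<theta>"
proof -
  define V where "V = \<theta> ` {1..m}"
  have "finite V" by (simp add: V_def)
  obtain \<tau> where \<tau>: "\<tau> \<in> bad_levels \<theta>"
    using assms(2) unfolding level_index_def by (metis (no_types, lifting) card.empty equals0I)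
  define A where "A = level_set \<theta> \<tau>"
  have A: "A \<subseteq> {1..m}" "A \<noteq> {}" using \<tau> by (auto simp: A_def)
  have "\<tau> \<in> V" and \<tau>_bad: "\<tau> \<noteq> block_mean n x A" using \<tau> by (auto simp: V_def A_def)
  obtain \<sigma> where \<sigma>: "\<tau> < \<sigma> \<and> \<sigma> \<le> block_mean n x A \<or> block_mean n x A \<le> \<sigma> \<and> \<sigma> < \<tau>"
      "\<sigma> = block_mean n x A \<or> \<sigma> \<in> V"
    and gap: "\<And>y. y \<in> V \<Longrightarrow> \<not> (\<tau> < y \<and> y < \<sigma>)" "\<And>y. y \<in> V \<Longrightarrow> \<not> (\<sigma> < y \<and> y < \<tau>)"
    using ex_next_value_toward[OF \<open>finite V\<close> \<tau>_bad] by blast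
  have "\<sigma> \<noteq> \<tau>" using \<sigma>(1) by auto
  have V_\<Theta>: "V \<subseteq> \<Theta>" using adm by (auto simp: V_def)
  then have "\<sigma> \<in> \<Theta>" using \<sigma>(2) block_mean_mem[OF A] by auto
  \<comment> \<open>Acting on values instead of indices moves the whole block at once. Order is
    preserved because no value lies strictly between \<tau> and \<sigma>.\<close>
  define h where "h v = (if v = \<tau> then \<sigma> else v)" for v
  define \<eta> where "\<eta> = h \<circ> \<theta>"
  have \<eta>_A: "\<eta> i = \<sigma>" "\<theta> i = \<tau>" if "i \<in> A" for i using that by (auto simp: \<eta>_def h_def A_def)
  have \<eta>_notA: "\<eta> i = \<theta> i" if "i \<in> {1..m} - A" for i using that by (auto simp: \<eta>_def h_def A_def)
  have "h u \<le> h v" if "u \<in> V" "v \<in> V" "u \<le> v" for u v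
    using that gap[of u] gap[of v] by (auto simp: h_def)
  moreover have "h ` V \<subseteq> \<Theta>"
    using V_\<Theta> \<open>\<sigma> \<in> \<Theta>\<close> by (auto simp: h_def)
  ultimately have adm': "admissible \<eta>"
    using adm by (auto simp: \<eta>_def V_def monotone_on_def)

  have "compound_likelihood f m n x \<theta> =
      (\<Prod>i\<in>{1..m} - A. \<Prod>j = 1..n i. f (x i j) (\<theta> i)) * block_likelihood A \<tau>"
    using \<eta>_A by (simp add: compound_likelihood_split[OF A(1)])
  \<comment> \<open>The block factor grows strictly, but the product may not: the factor from the
    other blocks may vanish.\<close>
  also have "\<dots> \<le> (\<Prod>i\<in>{1..m} - A. \<Prod>j = 1..n i. f (x i j) (\<theta> i)) * block_likelihood A \<sigma>"
    using block_likelihood_less[OF A _ \<open>\<sigma> \<in> \<Theta>\<close> \<sigma>(1)] \<open>\<tau> \<in> V\<close> V_\<Theta> adm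
    by (intro mult_left_mono prod_nonneg ballI nonneg) (auto simp: less_imp_le)
  also have "\<dots> = compound_likelihood f m n x \<eta>"
    using \<eta>_A \<eta>_notA by (simp add: compound_likelihood_split[OF A(1)])
  finally have lik: "compound_likelihood f m n x \<theta> \<le> compound_likelihood f m n x \<eta>" .

  have image: "\<eta> ` {1..m} = insert \<sigma> (V - {\<tau>})"
    using \<open>\<tau> \<in> V\<close> by (auto simp: \<eta>_def V_def h_def image_iff)
  have levels: "level_set \<eta> v = level_set \<theta> v" if "v \<noteq> \<sigma>" "v \<noteq> \<tau>" for v
    using that by (auto simp: \<eta>_def h_def)
  \<comment> \<open>The value \<tau> has disappeared, and every level other than \<sigma> keeps its
    level set, so only \<sigma> can become bad.\<close>
  have bad: "bad_levels \<eta> \<subseteq> insert \<sigma> (bad_levels \<theta> - {\<tau>})"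
  proof
    fix v assume v: "v \<in> bad_levels \<eta>"
    then have "v \<in> insert \<sigma> (V - {\<tau>})" using image by blast
    then show "v \<in> insert \<sigma> (bad_levels \<theta> - {\<tau>})"
      using v levels[of v] by (auto simp: V_def)
  qed
  have fin: "finite (bad_levels \<theta>)" by simp
  have card_bad: "card (bad_levels \<theta>) = Suc (card (bad_levels \<theta> - {\<tau>}))"
    by (rule card_Suc_Diff1[OF fin \<tau>, symmetric])
  have card_V: "card V = Suc (card (V - {\<tau>}))"
    by (rule card_Suc_Diff1[OF \<open>finite V\<close> \<open>\<tau> \<in> V\<close>, symmetric])
  have "card (\<eta> ` {1..m}) + level_index m n x \<eta> < card V + level_index m n x \<theta>"
  proof (cases "\<sigma> \<in> V")
    \<comment> \<open>Two blocks merge. The merged block may be bad, but this at most replaces the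
      lost bad level \<tau>, while one value is gone.\<close>
    case True
    have "card (\<eta> ` {1..m}) = card (V - {\<tau>})"
      unfolding image using True \<open>\<sigma> \<noteq> \<tau>\<close> by (simp add: insert_absorb)
    moreover have "card (bad_levels \<eta>) \<le> Suc (card (bad_levels \<theta> - {\<tau>}))"
      using fin by (intro order_trans[OF card_mono[OF _ bad]]) (auto simp: card_insert_if)
    ultimately show ?thesis
      using card_V card_bad unfolding level_index_def by linarith
  next
    \<comment> \<open>Now \<sigma> is the mean of \<open>A\<close>, and its level set is exactly
      \<open>A\<close>, so \<sigma> is not bad and the index drops.\<close>
    case False
    have "level_set \<eta> \<sigma> = A"
      using False by (auto simp: \<eta>_def h_def A_def V_def)
    then have "\<sigma> \<notin> bad_levels \<eta>" using False \<sigma>(2) by auto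
    then have "bad_levels \<eta> \<subseteq> bad_levels \<theta> - {\<tau>}" using bad by blast
    then have "card (bad_levels \<eta>) \<le> card (bad_levels \<theta> - {\<tau>})"
      using fin by (intro card_mono) auto
    moreover have "card (\<eta> ` {1..m}) \<le> Suc (card (V - {\<tau>}))"
      unfolding image using \<open>finite V\<close> by (simp add: card_insert_if)
    ultimately show ?thesis
      using card_V card_bad unfolding level_index_def by linarith
  qed
  then show ?thesis
    using that adm' lik by (simp add: V_def)
qed

section \<open>Descent to index zero and choice of the best vector\<close>

lemma dominated_by_index_zero:
  assumes "admissible \<theta>"
  shows "\<exists>\<eta>. admissible \<eta> \<and> level_index m n x \<eta> = 0 \<and>
           compound_likelihood f m n x \<theta> \<le> compound_likelihood f m n x \<eta>"
  using assms
proof (induction "card (\<theta> ` {1..m}) + level_index m n x \<theta>" arbitrary: \<theta> rule: less_induct)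
  case less
  show ?case
  proof (cases "level_index m n x \<theta> = 0")
    case True
    then show ?thesis using less.prems by blast
  next
    case False
    obtain \<eta> where "admissible \<eta>"
      and le: "compound_likelihood f m n x \<theta> \<le> compound_likelihood f m n x \<eta>"
      and "card (\<eta> ` {1..m}) + level_index m n x \<eta> < card (\<theta> ` {1..m}) + level_index m n x \<theta>"
      using improvement_step[OF less.prems False] by blast
    then show ?thesis using less.hyps[of \<eta>] order_trans[OF le] by blast
  qed
qed

text \<open>
  Restricting to \<open>{1..m}\<close> makes the set finite; without it the junk values at other indices would
  give infinitely many functions for each vector.
\<close>

lemma finite_index_zero:
  "finite {\<theta> \<in> extensional {1..m}. level_index m n x \<theta> = 0}"
proof (rule finite_subset)
  show "{\<theta> \<in> extensional {1..m}. level_index m n x \<theta> = 0}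
      \<subseteq> {1..m} \<rightarrow>\<^sub>E block_mean n x ` Pow {1..m}"
  proof clarify
    fix \<theta> assume "\<theta> \<in> extensional {1..m}" "level_index m n x \<theta> = 0"
    then show "\<theta> \<in> {1..m} \<rightarrow>\<^sub>E block_mean n x ` Pow {1..m}"
      using level_index_zeroD[of \<theta>] by (intro PiE_I image_eqI) (auto simp: extensional_def)
  qed
qed (intro finite_PiE; simp)

lemma index_zero_maximizer:
  "\<exists>\<theta>. admissible \<theta> \<and> level_index m n x \<theta> = 0 \<and> compound_likelihood f m n x \<theta> > 0 \<and>
     (\<forall>\<eta>. admissible \<eta> \<longrightarrow> compound_likelihood f m n x \<eta> \<le> compound_likelihood f m n x \<theta>)"
proof -
  define F where "F = {\<theta> \<in> extensional {1..m}. level_index m n x \<theta> = 0 \<and> admissible \<theta>}"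
  have "finite F"
    using finite_index_zero by (rule finite_subset[rotated]) (auto simp: F_def)
  have dom: "\<exists>\<theta>\<in>F. compound_likelihood f m n x \<eta> \<le> compound_likelihood f m n x \<theta>"
    if adm: "admissible \<eta>" for \<eta>
  proof -
    obtain \<theta> where \<theta>: "admissible \<theta>" "level_index m n x \<theta> = 0"
        "compound_likelihood f m n x \<eta> \<le> compound_likelihood f m n x \<theta>"
      using dominated_by_index_zero[OF adm] by blast
    \<comment> \<open>Restriction puts the dominating vector into the finite set \<open>F\<close>
      without changing its index, likelihood or admissibility.\<close>
    define \<theta>' where "\<theta>' = restrict \<theta> {1..m}"
    have eq: "\<theta>' i = \<theta> i" if "i \<in> {1..m}" for i using that by (simp add: \<theta>'_def)
    have "\<theta>' ` {1..m} = \<theta> ` {1..m}" "\<And>v. level_set \<theta>' v = level_set \<theta> v"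
      using eq by (auto simp: image_iff)
    then have "level_index m n x \<theta>' = 0"
      using \<theta>(2) by (simp add: level_index_def)
    moreover have "compound_likelihood f m n x \<theta>' = compound_likelihood f m n x \<theta>"
      using eq by (simp add: compound_likelihood_def)
    moreover have "admissible \<theta>'"
      using \<theta>(1) eq by (auto simp: monotone_on_def Pi_iff)
    moreover have "\<theta>' \<in> extensional {1..m}" by (simp add: \<theta>'_def)
    ultimately show ?thesis using \<theta>(3) by (auto simp: F_def)
  qed
  obtain a where "a \<in> \<Theta>" using nontrivial by blast
  \<comment> \<open>A constant vector is admissible, so some member of \<open>F\<close> dominates
    it.\<close>
  then have "F \<noteq> {}" using dom[of "\<lambda>_. a"] by (auto simp: monotone_on_def)
  obtain \<theta> where "\<theta> \<in> F"
    and max: "\<And>\<eta>. \<eta> \<in> F \<Longrightarrow> compound_likelihood f m n x \<eta> \<le> compound_likelihood f m n x \<theta>"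
    using obtains_MAX[OF \<open>finite F\<close> \<open>F \<noteq> {}\<close>, of "compound_likelihood f m n x"] \<open>finite F\<close>
    by (metis Max_ge finite_imageI imageI)
  show ?thesis
  proof (intro exI conjI allI impI)
    show "compound_likelihood f m n x \<eta> \<le> compound_likelihood f m n x \<theta>"
      if "admissible \<eta>" for \<eta>
      using dom[OF that] max order_trans by blast
  qed (use \<open>\<theta> \<in> F\<close> level_index_zero_pos in \<open>auto simp: F_def\<close>)
qed

end

end

theorem theorem1:
  fixes f :: "real \<Rightarrow> real \<Rightarrow> real" and \<Theta> :: "real set"
    and m :: nat and n :: "nat \<Rightarrow> nat" and x :: "nat \<Rightarrow> nat \<Rightarrow> real"
  assumes "pdf_family f \<Theta>"
    and "observable f \<Theta> \<subseteq> \<Theta>"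
    and "is_interval \<Theta>" and "\<exists>a\<in>\<Theta>. \<exists>b\<in>\<Theta>. a < b"
    and "likelihood_unimodal f \<Theta>"
    and "m \<ge> 1" and "\<forall>i\<in>{1..m}. n i \<ge> 1"
    and "\<forall>i\<in>{1..m}. \<forall>j\<in>{1..n i}. x i j \<in> observable f \<Theta>"
  shows "\<exists>\<theta> \<in> {1..m} \<rightarrow> \<Theta>. mono_on {1..m} \<theta> \<and>
           level_index m n x \<theta> = 0 \<and>
           compound_likelihood f m n x \<theta> > 0 \<and>
           (\<forall>\<eta> \<in> {1..m} \<rightarrow> \<Theta>. mono_on {1..m} \<eta> \<longrightarrow>
              compound_likelihood f m n x \<eta> \<le> compound_likelihood f m n x \<theta>)"
proof -
  note * = index_zero_maximizer[OF pdf_family_nonneg[OF assms(1)] assms(2-5), of m n x]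
  show ?thesis
    using * assms(7,8) by blast
qed

end
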